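(* Let $d\ge1$ and $m\ge0$ be integers and $\nu:=m/d$. Then $$\inf_L\sup_D\mathfrak R_m(L,D)\ \ge\ B_0(m,d)\ \ge\ B_1(\nu):=\sup_{b\in(0,1)}b\,\check{\operatorname{bayes}}(\nu,b),$$ where $\inf_L$ is either $\inf_{L\in\mathcal L}$ or $\inf_{L\in\mathcal L_{\mathsf{rand}}}$ (the inequalities hold in both cases), $\sup_D$ is over all probability distributions $D$ on $[d]\times\{-1,1\}$, and $B_0(m,d):=\sup_{b\in[0,1]}b\,\mathsf E\operatorname{bayes}(N,b)$ with $N$ a binomial random variable with parameters $m$ and $1/d$.
   Context: Setting: $\mathcal X=[d]=\{1,\dots,d\}$, $\mathcal Y=\{-1,1\}$, $\mathcal H=\mathcal Y^{\mathcal X}$. For a probability distribution $D$ on $\mathcal X\times\mathcal Y$, $(X^D,Y^D)$ is a random pair with distribution $D$, and $Z_m^D$ is the sequence of $m$ independent copies of it. Put $\operatorname{err}(h,D)=\mathsf P(h(X^D)\ne Y^D)$ and $\Delta(h,D)=\operatorname{err}(h,D)-\min_{g\in\mathcal H}\operatorname{err}(g,D)$. $\mathcal L$ is the set of all (non-randomized) learning algorithms, i.e. maps $L\colon(\mathcal X\times\mathcal Y)^m\to\mathcal H$; $\mathcal L_{\mathsf{rand}}$ is the set of all randomized learning algorithms, i.e. maps $L\colon(\mathcal X\times\mathcal Y)^m\times[-1,1]\to\mathcal H$ (measurable in the last argument). The expected excess risk is $\mathfrak R_m(L,D):=\mathsf E\,\Delta(L(Z_m^D),D)$ for $L\in\mathcal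 L$ and $\mathfrak R_m(L,D):=\mathsf E\,\Delta(L(Z_m^D,U),D)$ for $L\in\mathcal L_{\mathsf{rand}}$, with $U$ uniform on $[-1,1]$ and independent of $Z_m^D$. For $k\in\{0,1,\dots\}$ and $b\in[-1,1]$: $V^b_k:=Y^b_1+\dots+Y^b_k$, where the $Y^b_i$ are iid with $\mathsf P(Y^b_i=1)=\frac{1+b}2$, $\mathsf P(Y^b_i=-1)=\frac{1-b}2$ (so $V^b_0=0$); $s_k(b):=|\mathsf P(V^b_k>0)-\mathsf P(V^{-b}_k>0)|$; $\operatorname{bayes}(k,b):=\frac12\big(1-s_k(b)\big)$. For $b\in[0,1]$, the function $\kappa\mapsto\check{\operatorname{bayes}}(\kappa,b)$ on $[0,\infty)$ is the linear interpolation of $k\mapsto\operatorname{bayes}(k,b)$ at the points $0,1,3,5,\dots$: it equals $(1-\kappa)\operatorname{bayes}(0,b)+\kappa\operatorname{bayes}(1,b)$ for $0\le\kappa\le1$ and $\frac{2i+3-\kappa}2\operatorname{bayes}(2i+1,b)+\frac{\kappa-2i-1}2\operatorname{bayes}(2i+3,b)$ for $2i+1\le\kappa\le2i+3$, $i=0,1,\dots$. *)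

theory Defs
  imports "HOL-Probability.Probability"
begin

definition domain_X :: "nat \<Rightarrow> nat set" where
  "domain_X d = {1..d}"

definition labels_Y :: "int set" where
  "labels_Y = {-1, 1}"

definition hypotheses :: "nat \<Rightarrow> (nat \<Rightarrow> int) set" where
  "hypotheses d = domain_X d \<rightarrow>\<^sub>E labels_Y"

text \<open>A distribution on the finite set \<open>[d] \<times> {-1, 1}\<close> is a pmf supported there.\<close>

definition distributions :: "nat \<Rightarrow> (nat \<times> int) pmf set" where
  "distributions d = {D. set_pmf D \<subseteq> domain_X d \<times> labels_Y}"

text \<open>Elements of \<open>([d] \<times> {-1, 1})\<^sup>m\<close> are lists of length \<open>m\<close>; accordingly the law of \<open>m\<close>
  independent copies of a random pair with distribution \<open>D\<close> is \<open>replicate_pmf m D\<close>.\<close>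

definition samples :: "nat \<Rightarrow> nat \<Rightarrow> (nat \<times> int) list set" where
  "samples m d = {z. length z = m \<and> set z \<subseteq> domain_X d \<times> labels_Y}"

definition err :: "(nat \<Rightarrow> int) \<Rightarrow> (nat \<times> int) pmf \<Rightarrow> real" where
  "err h D = measure_pmf.prob D {(x, y). h x \<noteq> y}"

definition excess_risk :: "nat \<Rightarrow> (nat \<Rightarrow> int) \<Rightarrow> (nat \<times> int) pmf \<Rightarrow> real" where
  "excess_risk d h D = err h D - Min ((\<lambda>g. err g D) ` hypotheses d)"

definition learners :: "nat \<Rightarrow> nat \<Rightarrow> ((nat \<times> int) list \<Rightarrow> nat \<Rightarrow> int) set" where
  "learners m d = samples m d \<rightarrow>\<^sub>E hypotheses d"

text \<open>Randomized algorithms take the pair (sample, seed) as a single argument. Then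
  extensionality makes them constant off \<open>samples m d \<times> [-1, 1]\<close>, so that measurability in the
  seed gives measurability with respect to the product measure in \<open>risk_rand\<close>.\<close>

definition rand_learners :: "nat \<Rightarrow> nat \<Rightarrow> ((nat \<times> int) list \<times> real \<Rightarrow> nat \<Rightarrow> int) set" where
  "rand_learners m d =
    {L \<in> samples m d \<times> {-1..1} \<rightarrow>\<^sub>E hypotheses d.
      \<forall>z\<in>samples m d. (\<lambda>u. L (z, u)) \<in>
        measurable (restrict_space borel {-1..1}) (count_space (hypotheses d))}"

definition risk ::
  "nat \<Rightarrow> nat \<Rightarrow> ((nat \<times> int) list \<Rightarrow> nat \<Rightarrow> int) \<Rightarrow> (nat \<times> int) pmf \<Rightarrow> real" where
  "risk m d L D =
    measure_pmf.expectation (replicate_pmf m D) (\<lambda>z. excess_risk d (L z) D)"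

text \<open>Independence of the sample and the uniform seed is the product measure.\<close>

definition risk_rand ::
  "nat \<Rightarrow> nat \<Rightarrow> ((nat \<times> int) list \<times> real \<Rightarrow> nat \<Rightarrow> int) \<Rightarrow> (nat \<times> int) pmf \<Rightarrow> real" where
  "risk_rand m d L D =
    (\<integral>zu. excess_risk d (L zu) D
      \<partial>(measure_pmf (replicate_pmf m D) \<Otimes>\<^sub>M uniform_measure lborel {-1..1}))"

definition sign_pmf :: "real \<Rightarrow> int pmf" where
  "sign_pmf b = map_pmf (\<lambda>c. if c then 1 else -1) (bernoulli_pmf ((1 + b) / 2))"

definition V_pmf :: "nat \<Rightarrow> real \<Rightarrow> int pmf" where
  "V_pmf k b = map_pmf sum_list (replicate_pmf k (sign_pmf b))"

definition s_gap :: "nat \<Rightarrow> real \<Rightarrow> real" where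
  "s_gap k b =
    \<bar>measure_pmf.prob (V_pmf k b) {v. v > 0} - measure_pmf.prob (V_pmf k (-b)) {v. v > 0}\<bar>"

definition bayes :: "nat \<Rightarrow> real \<Rightarrow> real" where
  "bayes k b = 1/2 * (1 - s_gap k b)"

text \<open>Linear interpolation of \<open>bayes\<close> at the nodes 0, 1, 3, 5, \<dots>; for \<open>\<kappa> > 1\<close>, the index
  \<open>i\<close> below is the one with \<open>2 i + 1 \<le> \<kappa> < 2 i + 3\<close>.\<close>

definition bayes_check :: "real \<Rightarrow> real \<Rightarrow> real" where
  "bayes_check \<kappa> b =
    (if \<kappa> \<le> 1 then (1 - \<kappa>) * bayes 0 b + \<kappa> * bayes 1 b
     else let i = nat \<lfloor>(\<kappa> - 1) / 2\<rfloor> in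
       (2 * real i + 3 - \<kappa>) / 2 * bayes (2 * i + 1) b
       + (\<kappa> - 2 * real i - 1) / 2 * bayes (2 * i + 3) b)"

definition B\<^sub>0 :: "nat \<Rightarrow> nat \<Rightarrow> real" where
  "B\<^sub>0 m d = (SUP b\<in>{0..1}.
    b * measure_pmf.expectation (binomial_pmf m (1 / real d)) (\<lambda>n. bayes n b))"

definition B\<^sub>1 :: "real \<Rightarrow> real" where
  "B\<^sub>1 \<nu> = (SUP b\<in>{0<..<1}. b * bayes_check \<nu> b)"

end

theory Submission
  imports Defs
begin

text \<open>Lower bound on the minimax risk: let the first coordinate be uniform on \<open>[d]\<close> and give the label at \<open>x\<close>
  the bias \<open>b \<theta> x\<close>, where \<open>\<theta>\<close> is a vector of signs. The excess risk of \<open>h\<close> is then \<open>b / d\<close> times the number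
  of disagreements of \<open>h\<close> with \<open>\<theta>\<close>. Averaging over \<open>\<theta>\<close> and pairing \<open>\<theta>\<close> with its flip at \<open>x\<close> reduces the
  problem to testing two hypotheses. By Neyman and Pearson the sign of the sum of the labels observed
  at \<open>x\<close> is an optimal test; that sum has the law of \<open>V\<^sub>N\<close> with \<open>N\<close> binomial, so the average error
  probability is at least \<open>E bayes(N, b)\<close>. A random seed only averages this bound once more.

  Second inequality: \<open>s\<^sub>k(b)\<close> is \<open>b\<close> times a partial sum of the decreasing sequence of the return probabilities
  of a biased walk, so \<open>bayes_check\<close> has at \<open>\<nu> = E N\<close> a supporting line lying below \<open>bayes\<close> at all
  integers.\<close>

section \<open>Majority of biased signs\<close>

lemma prob_bind_pmf:
  "measure_pmf.prob (bind_pmf M f) A = measure_pmf.expectation M (\<lambda>x. measure_pmf.prob (f x) A)"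
proof -
  \<comment> \<open>Seen as the mass of \<open>True\<close> under the membership test, an event
    probability falls under \<open>pmf_bind\<close>.\<close>
  have eq: "measure_pmf.prob N A = pmf (map_pmf (\<lambda>x. x \<in> A) N) True" for N
    by (simp add: pmf_map vimage_def)
  show ?thesis
    by (simp add: eq map_bind_pmf pmf_bind)
qed

lemma map_sum_list_replicate_pmf_Suc:
  "map_pmf sum_list (replicate_pmf (Suc n) p)
     = bind_pmf p (\<lambda>x. map_pmf ((+) x) (map_pmf sum_list (replicate_pmf n p)))"
  by (simp add: map_bind_pmf map_pmf_def bind_assoc_pmf bind_return_pmf)

lemma V_pmf_0: "V_pmf 0 b = return_pmf 0"
  by (simp add: V_pmf_def)

lemma V_pmf_Suc: "V_pmf (Suc k) b = bind_pmf (sign_pmf b) (\<lambda>y. map_pmf ((+) y) (V_pmf k b))"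
  unfolding V_pmf_def by (rule map_sum_list_replicate_pmf_Suc)

text \<open>With \<open>n\<close> plus signs and \<open>k - n\<close> minus signs the sum is
  \<open>2 n - k\<close>.\<close>

lemma V_pmf_conv_binomial_pmf:
  assumes "b \<in> {-1..1}"
  shows "V_pmf k b = map_pmf (\<lambda>n. 2 * int n - int k) (binomial_pmf k ((1 + b) / 2))"
proof (induction k)
  case 0
  show ?case using assms by (simp add: V_pmf_0 binomial_pmf_0)
next
  case (Suc k)
  show ?case
    unfolding V_pmf_Suc Suc sign_pmf_def using assms
    by (auto simp: binomial_pmf_Suc map_pmf_def bind_assoc_pmf bind_return_pmf intro!: bind_pmf_cong)
qed

lemma prob_sign_pmf_bind:
  assumes "b \<in> {-1..1}"
  shows "measure_pmf.prob (bind_pmf (sign_pmf b) f) A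
    = (1 + b) / 2 * measure_pmf.prob (f 1) A + (1 - b) / 2 * measure_pmf.prob (f (-1)) A"
  using assms by (simp add: sign_pmf_def bind_map_pmf prob_bind_pmf field_simps)

text \<open>A tie needs as many plus as minus signs, so its probability is even in
  \<open>b\<close>.\<close>

lemma pmf_V_pmf_0:
  assumes "b \<in> {-1..1}"
  shows "pmf (V_pmf k b) 0
    = (if even k then real (k choose (k div 2)) * ((1 - b\<^sup>2) / 4) ^ (k div 2) else 0)"
proof (cases "even k")
  case True
  then obtain j where j: "k = 2 * j" by (elim evenE)
  have "(\<lambda>n. 2 * int n - int k) -` {0} = {j}" using j by auto
  then have "pmf (V_pmf k b) 0 = pmf (binomial_pmf k ((1 + b) / 2)) j"
    using assms by (simp add: V_pmf_conv_binomial_pmf pmf_map measure_pmf_single)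
  also have "\<dots> = real (k choose j) * (((1 + b) / 2) * (1 - (1 + b) / 2)) ^ j"
    using assms j by (subst pmf_binomial) (auto simp only: power_mult_distrib mult.assoc, auto)
  also have "((1 + b) / 2) * (1 - (1 + b) / 2) = (1 - b\<^sup>2) / 4"
    by (simp add: field_simps power2_eq_square)
  finally show ?thesis using j by simp
next
  case False
  then have "(\<lambda>n. 2 * int n - int k) -` {0} = {}" by auto presburger
  then show ?thesis using False assms by (simp add: V_pmf_conv_binomial_pmf pmf_map)
qed

text \<open>The value 1 takes one plus sign more than minus signs; the factor
  \<open>(1 - b) / 2\<close> balances the exponents, which makes the product even in
  \<open>b\<close>.\<close>

lemma pmf_V_pmf_1:
  assumes "b \<in> {-1..1}"
  shows "(1 - b) / 2 * pmf (V_pmf k b) 1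
    = (if odd k then real (k choose (Suc k div 2)) * ((1 - b\<^sup>2) / 4) ^ (Suc k div 2) else 0)"
proof (cases "odd k")
  case True
  then obtain j where j: "k = 2 * j + 1" by (elim oddE)
  have "(\<lambda>n. 2 * int n - int k) -` {1} = {Suc j}" using j by auto
  then have "pmf (V_pmf k b) 1 = pmf (binomial_pmf k ((1 + b) / 2)) (Suc j)"
    using assms by (simp add: V_pmf_conv_binomial_pmf pmf_map measure_pmf_single)
  also have "\<dots> = real (k choose Suc j) * ((1 + b) / 2) ^ Suc j * (1 - (1 + b) / 2) ^ j"
    using assms j by (subst pmf_binomial) auto
  also have "1 - (1 + b) / 2 = (1 - b) / 2" by (simp add: field_simps)
  finally have "(1 - b) / 2 * pmf (V_pmf k b) 1
      = real (k choose Suc j) * (((1 + b) / 2) * ((1 - b) / 2)) ^ Suc j"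
    by (simp only: power_mult_distrib power_Suc mult_ac)
  also have "((1 + b) / 2) * ((1 - b) / 2) = (1 - b\<^sup>2) / 4"
    by (simp add: field_simps power2_eq_square)
  finally show ?thesis using j by simp
next
  case False
  then have "(\<lambda>n. 2 * int n - int k) -` {1} = {}" by auto presburger
  then show ?thesis using False assms by (simp add: V_pmf_conv_binomial_pmf pmf_map)
qed

text \<open>One more sign makes the sum positive only by a step up from 0, and ends positivity only
  by a step down from 1.\<close>

lemma prob_V_pmf_Suc:
  assumes "b \<in> {-1..1}"
  shows "measure_pmf.prob (V_pmf (Suc k) b) {v. v > 0}
    = measure_pmf.prob (V_pmf k b) {v. v > 0}
      + (1 + b) / 2 * pmf (V_pmf k b) 0 - (1 - b) / 2 * pmf (V_pmf k b) 1"
proof -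
  let ?P = "measure_pmf.prob (V_pmf k b)"
  have "(+) 1 -` {v. v > 0} = {v::int. v > 0} \<union> {0}" "{v::int. v > 0} \<inter> {0} = {}" by auto
  then have 1: "?P ((+) 1 -` {v. v > 0}) = ?P {v. v > 0} + pmf (V_pmf k b) 0"
    by (metis measure_pmf.finite_measure_Union sets_measure_pmf UNIV_I measure_pmf_single)
  have "{v::int. v > 0} = (+) (-1) -` {v. v > 0} \<union> {1}" "(+) (-1) -` {v::int. v > 0} \<inter> {1} = {}"
    by auto
  then have 2: "?P {v. v > 0} = ?P ((+) (-1) -` {v. v > 0}) + pmf (V_pmf k b) 1"
    by (metis measure_pmf.finite_measure_Union sets_measure_pmf UNIV_I measure_pmf_single)
  show ?thesis
    unfolding V_pmf_Suc prob_sign_pmf_bind[OF assms] measure_map_pmf 1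
    using 2 by (simp add: field_simps)
qed

text \<open>The weight \<open>l\<close> is \<open>P(V\<^sub>2\<^sub>l = 0)\<close>: adding one more sign changes \<open>P(V\<^sup>b > 0) - P(V\<^sup>-\<^sup>b > 0)\<close>
  by \<open>b\<close> times the probability of a tie, and ties occur only at even times.\<close>

definition central_weight :: "real \<Rightarrow> nat \<Rightarrow> real" where
  "central_weight b l = real (2 * l choose l) * ((1 - b\<^sup>2) / 4) ^ l"

lemma prob_V_pmf_diff:
  assumes "b \<in> {-1..1}"
  shows "measure_pmf.prob (V_pmf k b) {v. v > 0} - measure_pmf.prob (V_pmf k (-b)) {v. v > 0}
    = b * (\<Sum>l<Suc k div 2. central_weight b l)"
proof (induction k)
  case 0
  show ?case by (simp add: V_pmf_0)
next
  case (Suc k)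
  from assms have b': "- b \<in> {-1..1}" by auto
  \<comment> \<open>Both sides are the chance of a step down from 1; being even in \<open>b\<close>,
    they cancel in the difference.\<close>
  have 1: "(1 - b) / 2 * pmf (V_pmf k b) 1 = (1 + b) / 2 * pmf (V_pmf k (-b)) 1"
    using pmf_V_pmf_1[OF assms, of k] pmf_V_pmf_1[OF b', of k] by simp
  have 0: "pmf (V_pmf k (-b)) 0 = pmf (V_pmf k b) 0"
    using pmf_V_pmf_0[OF assms] pmf_V_pmf_0[OF b'] by simp
  have "measure_pmf.prob (V_pmf (Suc k) b) {v. v > 0} - measure_pmf.prob (V_pmf (Suc k) (-b)) {v. v > 0}
     = b * (\<Sum>l<Suc k div 2. central_weight b l) + b * pmf (V_pmf k b) 0"
    unfolding prob_V_pmf_Suc[OF assms] prob_V_pmf_Suc[OF b'] 0 using 1 Suc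
    by (simp add: field_simps)
  \<comment> \<open>\<open>Suc k div 2\<close> counts the even times below \<open>k\<close>, so it
    grows exactly when \<open>k\<close> is even.\<close>
  also have "\<dots> = b * (\<Sum>l<Suc (Suc k) div 2. central_weight b l)"
    by (cases "even k")
      (auto simp: pmf_V_pmf_0[OF assms] central_weight_def algebra_simps elim!: evenE oddE)
  finally show ?case .
qed

section \<open>Monotone weights, supporting lines and the second inequality\<close>

lemma central_weight_nonneg: "b \<in> {-1..1} \<Longrightarrow> 0 \<le> central_weight b l"
  by (auto simp: central_weight_def abs_square_le_1 abs_le_iff intro!: mult_nonneg_nonneg zero_le_power)

lemma s_gap_eq:
  assumes "b \<in> {0..1}"
  shows "s_gap k b = b * (\<Sum>l<Suc k div 2. central_weight b l)"
proof -
  have b: "b \<in> {-1..1}" using assms by auto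
  show ?thesis
    unfolding s_gap_def prob_V_pmf_diff[OF b]
    using assms by (simp add: sum_nonneg central_weight_nonneg b)
qed

text \<open>By Pascal's rule the central binomial coefficient grows by a factor of at most 4, and
  \<open>(1 - b\<^sup>2) / 4\<close> is at most 1/4.\<close>

lemma central_weight_Suc_le:
  assumes "b \<in> {-1..1}"
  shows "central_weight b (Suc l) \<le> central_weight b l"
proof -
  have sym: "Suc (2 * l) choose l = Suc (2 * l) choose Suc l"
    using binomial_symmetric[of l "Suc (2 * l)"] by simp
  have "(2 * Suc l) choose (Suc l) = 2 * ((2 * l choose l) + (2 * l choose Suc l))"
    using sym by simp
  also have "\<dots> \<le> 4 * ((2 * l) choose l)"
    using binomial_maximum'[of l "Suc l"] by simp
  finally have "(2 * Suc l) choose (Suc l) \<le> 4 * ((2 * l) choose l)" .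
  then have "real ((2 * Suc l) choose (Suc l)) * ((1 - b\<^sup>2) / 4) \<le> (4 * real ((2 * l) choose l)) * ((1 - b\<^sup>2) / 4)"
    using assms by (intro mult_right_mono) (auto simp: abs_square_le_1 abs_le_iff)
  also have "\<dots> \<le> real ((2 * l) choose l)"
    by (simp add: algebra_simps)
  finally show ?thesis
    using assms unfolding central_weight_def power_Suc mult.assoc[symmetric]
    by (intro mult_right_mono zero_le_power) (auto simp: abs_square_le_1 abs_le_iff)
qed

text \<open>Partial sums of a decreasing sequence are concave in \<open>n\<close>. On either side of
  \<open>M\<close> the terms between are compared with \<open>c M\<close>, the slope of a supporting
  line.\<close>

lemma sum_decseq_le_tangent:
  fixes c :: "nat \<Rightarrow> real"
  assumes "decseq c"
  shows "sum c {..<n} \<le> sum c {..<M} + (real n - real M) * c M"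
proof (cases "M \<le> n")
  case True
  then have "sum c {..<n} = sum c {..<M} + sum c {M..<n}"
    by (metis ivl_disj_un_one(2) ivl_disj_int_one(2) finite_lessThan finite_atLeastLessThan
        sum.union_disjoint)
  moreover have "sum c {M..<n} \<le> of_nat (card {M..<n}) * c M"
    by (intro sum_bounded_above) (use assms in \<open>auto simp: decseq_def\<close>)
  ultimately show ?thesis using True by (simp add: of_nat_diff)
next
  case False
  then have "sum c {..<M} = sum c {..<n} + sum c {n..<M}"
    by (metis ivl_disj_un_one(2) ivl_disj_int_one(2) finite_lessThan finite_atLeastLessThan
        sum.union_disjoint nle_le)
  moreover have "of_nat (card {n..<M}) * c M \<le> sum c {n..<M}"
    by (intro sum_bounded_below) (use assms in \<open>auto simp: decseq_def\<close>)
  ultimately show ?thesis using False by (simp add: of_nat_diff algebra_simps)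
qed

lemma expectation_binomial_affine:
  assumes "p \<in> {0..1}"
  shows "measure_pmf.expectation (binomial_pmf m p) (\<lambda>n. \<alpha> + \<beta> * real n) = \<alpha> + \<beta> * (real m * p)"
proof -
  have "measure_pmf.expectation (binomial_pmf m p) real = (\<Sum>k\<le>m. real k * Bernstein m k p)"
    using assms by (simp add: expectation_binomial_pmf' Bernstein_def algebra_simps)
  then have "measure_pmf.expectation (binomial_pmf m p) real = real m * p"
    by (simp add: sum_k_Bernstein)
  then show ?thesis using assms by simp
qed

text \<open>Along the nodes 0, 1, 3, 5, \<dots> the values \<open>bayes k b\<close> are convex, and at the skipped even \<open>k\<close> they equal
  the value at \<open>k - 1\<close>. So the line through the two nodes enclosing \<open>\<nu>\<close> stays below \<open>bayes\<close> at every integer;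
  this replaces Jensen's inequality for \<open>bayes_check\<close>.\<close>

lemma bayes_check_eq_affine:
  assumes b: "b \<in> {0..1}" and "\<nu> \<ge> 0"
  obtains \<alpha> \<beta> where "bayes_check \<nu> b = \<alpha> + \<beta> * \<nu>" "\<And>k. \<alpha> + \<beta> * real k \<le> bayes k b"
proof (cases "\<nu> \<le> 1")
  let ?c = "central_weight b"
  have b': "b \<in> {-1..1}" using b by auto
  have dec: "decseq ?c"
    by (intro decseq_SucI central_weight_Suc_le b')
  have c0: "?c 0 = 1" by (simp add: central_weight_def)
  case True
  show ?thesis
  proof (rule that)
    \<comment> \<open>The line through the nodes 0 and 1, with values \<open>1/2\<close> and
      \<open>(1 - b) / 2\<close>.\<close>
    show "bayes_check \<nu> b = 1/2 + (-b/2) * \<nu>"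
      using True b by (simp add: bayes_check_def bayes_def s_gap_eq c0 field_simps)
    fix k
    have "sum ?c {..<Suc k div 2} \<le> real (Suc k div 2)"
      using sum_decseq_le_tangent[OF dec, of "Suc k div 2" 0] by (simp add: c0)
    also have "\<dots> \<le> real k" by (intro of_nat_mono) presburger
    finally have "b * sum ?c {..<Suc k div 2} \<le> b * real k"
      using b by (intro mult_left_mono) auto
    then show "1/2 + (-b/2) * real k \<le> bayes k b"
      using b by (simp add: bayes_def s_gap_eq field_simps)
  qed
next
  let ?c = "central_weight b"
  have b': "b \<in> {-1..1}" using b by auto
  have dec: "decseq ?c"
    by (intro decseq_SucI central_weight_Suc_le b')
  case False
  define i where "i = nat \<lfloor>(\<nu> - 1) / 2\<rfloor>"
  \<comment> \<open>The number of weights in \<open>s_gap\<close> at the left node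
    \<open>2 * i + 1\<close>.\<close>
  let ?M = "Suc i"
  show ?thesis
  proof (rule that)
    have i1: "Suc (2 * i + 1) div 2 = ?M" "Suc (2 * i + 3) div 2 = Suc ?M" by simp_all
    \<comment> \<open>Between the nodes, at distance 2, \<open>bayes\<close> drops by
      \<open>b * ?c ?M / 2\<close>; this gives the slope.\<close>
    show "bayes_check \<nu> b = 1/2 - b / 2 * (sum ?c {..<?M} - (2 * real i + 1) / 2 * ?c ?M)
        + (- b * ?c ?M / 4) * \<nu>"
      using False
      unfolding bayes_check_def Let_def i_def[symmetric] bayes_def s_gap_eq[OF b] i1
      by (simp add: field_simps)
    fix k
    have "sum ?c {..<Suc k div 2} \<le> sum ?c {..<?M} + (real (Suc k div 2) - real ?M) * ?c ?M"
      by (rule sum_decseq_le_tangent[OF dec])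
    \<comment> \<open>\<open>Suc k div 2\<close> equals \<open>(k + 1) / 2\<close> for odd
      \<open>k\<close> and is smaller for even \<open>k\<close>.\<close>
    also have "\<dots> \<le> sum ?c {..<?M} + (real k + 1 - 2 * real ?M) / 2 * ?c ?M"
      by (intro add_left_mono mult_right_mono central_weight_nonneg b')
        (cases "even k"; auto elim!: evenE oddE simp: field_simps)
    finally have "b * sum ?c {..<Suc k div 2}
        \<le> b * (sum ?c {..<?M} + (real k + 1 - 2 * real ?M) / 2 * ?c ?M)"
      using b by (intro mult_left_mono) auto
    then show "1/2 - b / 2 * (sum ?c {..<?M} - (2 * real i + 1) / 2 * ?c ?M)
        + (- b * ?c ?M / 4) * real k \<le> bayes k b"
      using b by (simp add: bayes_def s_gap_eq field_simps)
  qed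
qed

abbreviation mean_bayes :: "nat \<Rightarrow> nat \<Rightarrow> real \<Rightarrow> real" where
  "mean_bayes m d b \<equiv> measure_pmf.expectation (binomial_pmf m (1 / real d)) (\<lambda>n. bayes n b)"

text \<open>The expectation of an affine function depends only on the mean \<open>m / d\<close> of
  the binomial variable.\<close>

lemma bayes_check_le_expectation:
  assumes "b \<in> {0..1}" "d \<ge> 1"
  shows "bayes_check (real m / real d) b
    \<le> mean_bayes m d b"
proof -
  have p: "1 / real d \<in> {0..1}" using assms by auto
  obtain \<alpha> \<beta> where ab: "bayes_check (real m / real d) b = \<alpha> + \<beta> * (real m / real d)"
      "\<And>k. \<alpha> + \<beta> * real k \<le> bayes k b"
    using bayes_check_eq_affine[OF assms(1), of "real m / real d"] by auto
  have "\<alpha> + \<beta> * (real m / real d)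
      = measure_pmf.expectation (binomial_pmf m (1 / real d)) (\<lambda>n. \<alpha> + \<beta> * real n)"
    by (simp add: expectation_binomial_affine[OF p])
  also have "\<dots> \<le> mean_bayes m d b"
    by (intro integral_mono integrable_binomial_pmf p ab(2))
  finally show ?thesis using ab(1) by simp
qed

lemma bayes_bounds: "0 \<le> bayes k b" "bayes k b \<le> 1 / 2"
proof -
  have "\<bar>measure_pmf.prob M A - measure_pmf.prob N A\<bar> \<le> 1" for M N :: "int pmf" and A
    by (smt (verit) measure_nonneg measure_pmf.prob_le_1)
  then show "0 \<le> bayes k b" "bayes k b \<le> 1 / 2" by (simp_all add: bayes_def s_gap_def)
qed

text \<open>Comparing real suprema requires the larger family to be bounded.\<close>

lemma B0_bdd_above:
  assumes "d \<ge> 1"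
  shows "bdd_above ((\<lambda>b. b * mean_bayes m d b) ` {0..1})"
proof (rule bdd_aboveI2)
  have p: "1 / real d \<in> {0..1}" using assms by auto
  fix b :: real assume b: "b \<in> {0..1}"
  have "mean_bayes m d b
     \<le> measure_pmf.expectation (binomial_pmf m (1 / real d)) (\<lambda>n. 1/2)"
    by (intro integral_mono integrable_binomial_pmf p bayes_bounds)
  then show "b * mean_bayes m d b \<le> 1"
    using b by (intro mult_le_one Bochner_Integration.integral_nonneg bayes_bounds) auto
qed

lemma B1_le_B0:
  assumes "d \<ge> 1"
  shows "B\<^sub>1 (real m / real d) \<le> B\<^sub>0 m d"
  unfolding B\<^sub>1_def B\<^sub>0_def
proof (rule cSUP_mono[OF _ B0_bdd_above[OF assms]])
  fix b :: real assume b: "b \<in> {0<..<1}"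
  then show "\<exists>b'\<in>{0..1}. b * bayes_check (real m / real d) b
     \<le> b' * mean_bayes m d b'"
    using bayes_check_le_expectation[OF _ assms, of b] by (intro bexI[of _ b] mult_left_mono) auto
qed auto

section \<open>Testing the bias of one label\<close>

lemma prob_mono_pmf:
  assumes "\<And>x. x \<in> A \<Longrightarrow> pmf P x \<le> pmf Q x"
  shows "measure_pmf.prob P A \<le> measure_pmf.prob Q A"
  unfolding measure_pmf_conv_infsetsum using assms by (intro infsetsum_mono pmf_abs_summable)

text \<open>Passing from \<open>A\<close> to \<open>T\<close> removes only points where
  \<open>Q\<close> dominates and adds only points where \<open>P\<close> dominates. Points of equal
  mass may lie on either side.\<close>

lemma Neyman_Pearson_pmf:
  assumes "\<And>x. x \<in> T \<Longrightarrow> pmf Q x \<le> pmf P x" and "\<And>x. x \<notin> T \<Longrightarrow> pmf P x \<le> pmf Q x"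
  shows "measure_pmf.prob P A - measure_pmf.prob Q A \<le> measure_pmf.prob P T - measure_pmf.prob Q T"
proof -
  have "measure_pmf.prob P (A - T) \<le> measure_pmf.prob Q (A - T)"
       "measure_pmf.prob Q (T - A) \<le> measure_pmf.prob P (T - A)"
    using assms by (auto intro!: prob_mono_pmf)
  moreover have "measure_pmf.prob R B = measure_pmf.prob R (B \<inter> C) + measure_pmf.prob R (B - C)"
    for R :: "'a pmf" and B C
    using measure_pmf.finite_measure_Union[of "B \<inter> C" R "B - C"] by (simp add: Int_Diff_Un Int_Diff_disjoint)
  ultimately show ?thesis
    by (smt (verit) Int_commute)
qed

lemma map_replicate_pmf: "map_pmf (map f) (replicate_pmf n p) = replicate_pmf n (map_pmf f p)"
proof (induction n)
  case (Suc n)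
  have "replicate_pmf (Suc n) (map_pmf f p)
      = bind_pmf p (\<lambda>x. map_pmf ((#) (f x)) (map_pmf (map f) (replicate_pmf n p)))"
    unfolding Suc by (simp add: bind_map_pmf) (simp only: map_pmf_def)
  then show ?case
    by (simp add: map_pmf_def bind_assoc_pmf bind_return_pmf)
qed simp

lemma pmf_replicate_pmf_Suc_Cons:
  "pmf (replicate_pmf (Suc n) p) (x # xs) = pmf p x * pmf (replicate_pmf n p) xs"
proof -
  have "replicate_pmf (Suc n) p = map_pmf (\<lambda>(x, xs). x # xs) (pair_pmf p (replicate_pmf n p))"
    by (simp add: pair_pmf_def map_bind_pmf map_pmf_def bind_assoc_pmf bind_return_pmf)
  moreover have "inj (\<lambda>(x, xs). x # xs)" by (auto simp: inj_on_def)
  ultimately show ?thesis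
    using pmf_map_inj'[of "\<lambda>(x, xs). x # xs" "pair_pmf p (replicate_pmf n p)" "(x, xs)"]
    by (simp add: pmf_pair)
qed

text \<open>Examples at other points count as 0, so for an iid sample this is a sum of iid
  terms.\<close>

definition net_label :: "'a \<Rightarrow> ('a \<times> int) list \<Rightarrow> int" where
  "net_label x z = sum_list (map (\<lambda>(x', y). if x' = x then y else 0) z)"

text \<open>Here \<open>i\<close> and \<open>j\<close> count the labels 1 and -1 observed at
  \<open>x\<close>, and \<open>C\<close> collects the examples elsewhere, where \<open>P\<close> and
  \<open>Q\<close> agree. Both masses vanish on lists of the wrong length or with another label at
  \<open>x\<close>.\<close>

lemma likelihood_factorization:
  fixes P Q :: "('a \<times> int) pmf"
  assumes off: "\<And>x' y. x' \<noteq> x \<Longrightarrow> pmf P (x', y) = pmf Q (x', y)"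
    and at: "pmf P (x, 1) = p" "pmf Q (x, 1) = q" "pmf P (x, -1) = q" "pmf Q (x, -1) = p"
    and zero: "\<And>y. y \<notin> {-1, 1} \<Longrightarrow> pmf P (x, y) = 0 \<and> pmf Q (x, y) = 0"
  shows "pmf (replicate_pmf n P) z = 0 \<and> pmf (replicate_pmf n Q) z = 0
    \<or> (\<exists>C\<ge>0. \<exists>i j. net_label x z = int i - int j
          \<and> pmf (replicate_pmf n P) z = C * (p ^ i * q ^ j)
          \<and> pmf (replicate_pmf n Q) z = C * (q ^ i * p ^ j))"
proof (induction n arbitrary: z)
  case 0
  show ?case
    by (cases "z = []")
      (auto simp: net_label_def indicator_def intro!: exI[of _ "1::real"] exI[of _ "0::nat"])
next
  case (Suc n)
  show ?case
  proof (cases z)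
    case Nil
    then have "z \<notin> set_pmf (replicate_pmf (Suc n) R)" for R :: "('a \<times> int) pmf"
      unfolding set_replicate_pmf by simp
    then show ?thesis by (metis pmf_eq_0_set_pmf)
  next
    case (Cons a z')
    obtain x' y where a: "a = (x', y)" by force
    have net: "net_label x z = (if x' = x then y else 0) + net_label x z'"
      by (simp add: net_label_def Cons a)
    note z = Cons[unfolded a] pmf_replicate_pmf_Suc_Cons
    from Suc.IH[of z'] show ?thesis
    proof (elim disjE exE conjE)
      assume "pmf (replicate_pmf n P) z' = 0" "pmf (replicate_pmf n Q) z' = 0"
      then show ?thesis unfolding z by simp
    next
      fix C i j
      assume C: "0 \<le> C" and IH: "net_label x z' = int i - int j"
        "pmf (replicate_pmf n P) z' = C * (p ^ i * q ^ j)"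
        "pmf (replicate_pmf n Q) z' = C * (q ^ i * p ^ j)"
      consider "x' \<noteq> x" | "x' = x" "y = 1" | "x' = x" "y = -1" | "x' = x" "y \<notin> {-1, 1}"
        by blast
      then show ?thesis
      proof cases
        case 1
        have "net_label x z = int i - int j"
          using 1 IH(1) by (simp add: net)
        moreover have "pmf (replicate_pmf (Suc n) P) z = (pmf Q (x', y) * C) * (p ^ i * q ^ j)"
            "pmf (replicate_pmf (Suc n) Q) z = (pmf Q (x', y) * C) * (q ^ i * p ^ j)"
          unfolding z IH using 1 by (simp_all add: off)
        moreover have "0 \<le> (pmf Q (x', y) * C)" using C by simp
        ultimately show ?thesis by blast
      next
        case 2
        have "net_label x z = int (Suc i) - int j"
          using 2 IH(1) by (simp add: net)
        moreover have "pmf (replicate_pmf (Suc n) P) z = C * (p ^ (Suc i) * q ^ j)"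
            "pmf (replicate_pmf (Suc n) Q) z = C * (q ^ (Suc i) * p ^ j)"
          unfolding z IH using 2 by (simp_all add: at)
        moreover have "0 \<le> C" using C by simp
        ultimately show ?thesis by blast
      next
        case 3
        have "net_label x z = int i - int (Suc j)"
          using 3 IH(1) by (simp add: net)
        moreover have "pmf (replicate_pmf (Suc n) P) z = C * (p ^ i * q ^ (Suc j))"
            "pmf (replicate_pmf (Suc n) Q) z = C * (q ^ i * p ^ (Suc j))"
          unfolding z IH using 3 by (simp_all add: at)
        moreover have "0 \<le> C" using C by simp
        ultimately show ?thesis by blast
      next
        case 4
        then show ?thesis using zero unfolding z by auto
      qed
    qed
  qed
qed

text \<open>After removing the common factor \<open>(p * q) ^ j\<close>, the powers with exponent
  \<open>i - j\<close> remain.\<close>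

lemma power_swap_le:
  fixes p q :: real
  assumes "0 \<le> q" "q \<le> p" "j \<le> i"
  shows "q ^ i * p ^ j \<le> p ^ i * q ^ j"
proof -
  obtain t where t: "i = j + t" using assms(3) le_iff_add by blast
  have "(p * q) ^ j * q ^ t \<le> (p * q) ^ j * p ^ t"
    using assms by (intro mult_left_mono power_mono) auto
  then show ?thesis by (simp add: t power_add power_mult_distrib mult_ac)
qed

text \<open>The likelihood ratio is \<open>p / q\<close> to the power \<open>net_label x z\<close>,
  so its sign decides which hypothesis is likelier; at 0 the likelihoods are equal.\<close>

lemma likelihood_comparison:
  fixes P Q :: "('a \<times> int) pmf"
  assumes "\<And>x' y. x' \<noteq> x \<Longrightarrow> pmf P (x', y) = pmf Q (x', y)"
    and "pmf P (x, 1) = p" "pmf Q (x, 1) = q" "pmf P (x, -1) = q" "pmf Q (x, -1) = p"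
    and "\<And>y. y \<notin> {-1, 1} \<Longrightarrow> pmf P (x, y) = 0 \<and> pmf Q (x, y) = 0"
    and "q \<le> p"
  shows "net_label x z > 0 \<Longrightarrow> pmf (replicate_pmf n Q) z \<le> pmf (replicate_pmf n P) z"
    and "\<not> net_label x z > 0 \<Longrightarrow> pmf (replicate_pmf n P) z \<le> pmf (replicate_pmf n Q) z"
proof -
  have q: "0 \<le> q" using assms(3) by auto
  note swap = power_swap_le[OF q assms(7)]
  have fact: "pmf (replicate_pmf n P) z = 0 \<and> pmf (replicate_pmf n Q) z = 0
    \<or> (\<exists>C\<ge>0. \<exists>i j. net_label x z = int i - int j
          \<and> pmf (replicate_pmf n P) z = C * (p ^ i * q ^ j)
          \<and> pmf (replicate_pmf n Q) z = C * (q ^ i * p ^ j))"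
    using assms by (intro likelihood_factorization)
  show "pmf (replicate_pmf n Q) z \<le> pmf (replicate_pmf n P) z" if "net_label x z > 0"
    using fact that by (auto intro!: mult_left_mono swap)
  show "pmf (replicate_pmf n P) z \<le> pmf (replicate_pmf n Q) z" if "\<not> net_label x z > 0"
    using fact that
  proof (elim disjE exE conjE)
    fix C i j
    assume "0 \<le> C" "net_label x z = int i - int j"
      "pmf (replicate_pmf n P) z = C * (p ^ i * q ^ j)"
      "pmf (replicate_pmf n Q) z = C * (q ^ i * p ^ j)"
    \<comment> \<open>Now \<open>i \<le> j\<close>, so the exponents are exchanged in the
      swap.\<close>
    with that swap[of i j] show ?thesis by (simp add: mult_left_mono mult.commute)
  qed simp
qed

text \<open>Each term is kept as a sign with probability \<open>p\<close> and is 0 otherwise. The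
  number of kept terms is binomial, and given that number they are iid signs.\<close>

lemma map_sum_list_thinned_signs:
  assumes "p \<in> {0..1}"
  shows "map_pmf sum_list (replicate_pmf m
      (bind_pmf (bernoulli_pmf p) (\<lambda>c. if c then sign_pmf b else return_pmf 0)))
    = bind_pmf (binomial_pmf m p) (\<lambda>n. V_pmf n b)" (is "map_pmf _ (replicate_pmf _ ?W) = _")
proof (induction m)
  case 0
  show ?case using assms by (simp add: binomial_pmf_0 bind_return_pmf V_pmf_0)
next
  case (Suc m)
  let ?B = "binomial_pmf m p"
  \<comment> \<open>The new sign is independent of the count, so the order of drawing can be
    exchanged.\<close>
  have "bind_pmf (sign_pmf b) (\<lambda>y. map_pmf ((+) y) (bind_pmf ?B (\<lambda>n. V_pmf n b)))
      = bind_pmf ?B (\<lambda>n. V_pmf (Suc n) b)"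
    unfolding map_bind_pmf V_pmf_Suc by (rule bind_commute_pmf)
  moreover have "map_pmf ((+) 0) M = M" for M :: "int pmf"
    by (simp add: map_pmf_idI)
  ultimately show ?case
    unfolding map_sum_list_replicate_pmf_Suc Suc binomial_pmf_Suc[OF assms] bind_assoc_pmf
    by (intro bind_pmf_cong) (auto simp: bind_return_pmf)
qed

section \<open>The hard distributions\<close>

definition hard_pmf :: "nat \<Rightarrow> real \<Rightarrow> (nat \<Rightarrow> int) \<Rightarrow> (nat \<times> int) pmf" where
  "hard_pmf d b \<theta> =
    bind_pmf (pmf_of_set (domain_X d)) (\<lambda>x. map_pmf (Pair x) (sign_pmf (b * real_of_int (\<theta> x))))"

lemma domain_X_simps [simp]:
  "finite (domain_X d)" "card (domain_X d) = d" "d \<ge> 1 \<Longrightarrow> domain_X d \<noteq> {}"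
  by (auto simp: domain_X_def)

lemma set_sign_pmf: "set_pmf (sign_pmf b) \<subseteq> {-1, 1}"
  by (auto simp: sign_pmf_def)

lemma hard_pmf_in_distributions: "d \<ge> 1 \<Longrightarrow> hard_pmf d b \<theta> \<in> distributions d"
  using set_sign_pmf by (fastforce simp: distributions_def hard_pmf_def labels_Y_def)

lemma pmf_sign_pmf:
  assumes "b \<in> {-1..1}"
  shows "pmf (sign_pmf b) y = (if y \<in> {-1, 1} then (1 + b * real_of_int y) / 2 else 0)"
proof (cases "y \<in> {-1, 1}")
  case True
  then have "(if c then 1 else -1) = y \<longleftrightarrow> c = (y = 1)" for c
    by (cases c) auto
  then have "(\<lambda>c. if c then 1 else -1) -` {y} = {y = 1}"
    by (simp add: vimage_def)
  then have "pmf (sign_pmf b) y = pmf (bernoulli_pmf ((1 + b) / 2)) (y = 1)"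
    by (simp only: sign_pmf_def pmf_map measure_pmf_single)
  then show ?thesis using True assms by (auto simp: field_simps)
next
  case False
  then show ?thesis using set_sign_pmf[of b] by (auto simp: pmf_eq_0_set_pmf)
qed

lemma pmf_hard_pmf:
  assumes "d \<ge> 1"
  shows "pmf (hard_pmf d b \<theta>) (x, y)
    = (if x \<in> domain_X d then pmf (sign_pmf (b * real_of_int (\<theta> x))) y / real d else 0)"
proof -
  have "Pair x' -` {(x, y)} = (if x' = x then {y} else {})" for x' :: nat
    by auto
  then have "pmf (map_pmf (Pair x') M) (x, y) = (if x' = x then pmf M y else 0)"
    for x' :: nat and M :: "int pmf"
    by (simp add: pmf_map measure_pmf_single)
  then show ?thesis
    using assms by (simp add: hard_pmf_def pmf_bind_pmf_of_set sum.delta')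
qed

text \<open>An example hits \<open>x\<close> with probability \<open>1 / d\<close> and then shows a
  biased sign, which is the thinned term above.\<close>

lemma map_hard_pmf:
  assumes "d \<ge> 1" "x \<in> domain_X d"
  shows "map_pmf (\<lambda>(x', y). if x' = x then y else 0) (hard_pmf d b \<theta>)
    = bind_pmf (bernoulli_pmf (1 / real d))
        (\<lambda>c. if c then sign_pmf (b * real_of_int (\<theta> x)) else return_pmf 0)"
proof -
  have "map_pmf (\<lambda>x'. x' = x) (pmf_of_set (domain_X d)) = bernoulli_pmf (1 / real d)"
  proof (rule pmf_eqI)
    fix c
    have "(\<lambda>x'. x' = x) -` {c} = (if c then {x} else - {x})" by auto
    moreover have "domain_X d \<inter> {x} = {x}" "domain_X d \<inter> - {x} = domain_X d - {x}"
      using assms by auto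
    ultimately show "pmf (map_pmf (\<lambda>x'. x' = x) (pmf_of_set (domain_X d))) c
        = pmf (bernoulli_pmf (1 / real d)) c"
      using assms
      by (cases c) (simp_all add: pmf_map measure_pmf_of_set card_Diff_singleton of_nat_diff diff_divide_distrib)
  qed
  from this[symmetric] show ?thesis
    unfolding hard_pmf_def map_bind_pmf
    by (auto simp: bind_map_pmf pmf.map_comp o_def case_prod_beta map_pmf_const intro!: bind_pmf_cong)
qed

lemma net_label_law:
  assumes "d \<ge> 1" "x \<in> domain_X d"
  shows "map_pmf (net_label x) (replicate_pmf m (hard_pmf d b \<theta>))
    = bind_pmf (binomial_pmf m (1 / real d)) (\<lambda>n. V_pmf n (b * real_of_int (\<theta> x)))"
proof -
  have "net_label x = sum_list \<circ> map (\<lambda>(x', y). if x' = x then y else 0)"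
    by (simp add: net_label_def fun_eq_iff)
  then have "map_pmf (net_label x) (replicate_pmf m (hard_pmf d b \<theta>))
     = map_pmf sum_list (replicate_pmf m (map_pmf (\<lambda>(x', y). if x' = x then y else 0) (hard_pmf d b \<theta>)))"
    by (simp add: map_replicate_pmf flip: pmf.map_comp)
  then show ?thesis
    using assms by (simp add: map_hard_pmf map_sum_list_thinned_signs)
qed

text \<open>The two distributions differ only at \<open>x\<close>, and \<open>g\<close> is an
  arbitrary guess of the sign there. Its two error probabilities sum to at least one minus the best
  difference \<open>P' T - Q' T\<close>, attained by the sign of \<open>net_label\<close>.\<close>

lemma two_point_bound:
  assumes d: "d \<ge> 1" and x: "x \<in> domain_X d" and b: "b \<in> {0..1}"
    and \<theta>: "\<theta> x = 1"
  shows "2 * mean_bayes m d b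
    \<le> measure_pmf.prob (replicate_pmf m (hard_pmf d b \<theta>)) {z. g z \<noteq> 1}
      + measure_pmf.prob (replicate_pmf m (hard_pmf d b (\<theta>(x := -1)))) {z. g z \<noteq> (-1::int)}"
proof -
  let ?P = "hard_pmf d b \<theta>" and ?Q = "hard_pmf d b (\<theta>(x := -1))"
  let ?P' = "measure_pmf.prob (replicate_pmf m ?P)" and ?Q' = "measure_pmf.prob (replicate_pmf m ?Q)"
  let ?T = "{z. net_label x z > 0}" and ?B = "binomial_pmf m (1 / real d)"
  let ?V = "\<lambda>b n. measure_pmf.prob (V_pmf n b) {v. v > 0}"
  have pd: "1 / real d \<in> {0..1}" using d by auto
  note [simp] = integrable_binomial_pmf[OF pd]
  have b': "b \<in> {-1..1}" "-b \<in> {-1..1}" using b by auto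
  let ?p = "(1 + b) / (2 * real d)" and ?q = "(1 - b) / (2 * real d)"
  have off: "pmf ?P (x', y) = pmf ?Q (x', y)" if "x' \<noteq> x" for x' y
    using that by (simp add: pmf_hard_pmf[OF d])
  have at: "pmf ?P (x, 1) = ?p" "pmf ?Q (x, 1) = ?q" "pmf ?P (x, -1) = ?q" "pmf ?Q (x, -1) = ?p"
    using x b' \<theta> by (simp_all add: pmf_hard_pmf[OF d] pmf_sign_pmf)
  have zero: "pmf ?P (x, y) = 0 \<and> pmf ?Q (x, y) = 0" if "y \<notin> {-1, 1}" for y
    using that b' \<theta> by (simp add: pmf_hard_pmf[OF d] pmf_sign_pmf)
  have "?q \<le> ?p" using b by (intro divide_right_mono) auto
  note comp = likelihood_comparison[where P = ?P and Q = ?Q, OF off at zero this]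
  have "?P' {z. g z \<noteq> 1} = 1 - ?P' {z. g z = 1}"
    using measure_pmf.prob_compl[of "{z. g z = 1}" "replicate_pmf m ?P"]
    by (simp add: Compl_eq_Diff_UNIV[symmetric] Collect_neg_eq)
  \<comment> \<open>Only an inequality, since \<open>g\<close> may take values other than 1 and
    -1.\<close>
  moreover have "?Q' {z. g z = 1} \<le> ?Q' {z. g z \<noteq> -1}"
    by (intro measure_pmf.finite_measure_mono) auto
  moreover have "?P' {z. g z = 1} - ?Q' {z. g z = 1} \<le> ?P' ?T - ?Q' ?T"
    by (rule Neyman_Pearson_pmf) (auto intro: comp)
  moreover have "?P' ?T = measure_pmf.expectation ?B (?V b)"
    using arg_cong[OF net_label_law[OF d x], of "\<lambda>M. measure_pmf.prob M {v. v > 0}" m b \<theta>] \<theta>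
    by (simp add: prob_bind_pmf vimage_def)
  moreover have "?Q' ?T = measure_pmf.expectation ?B (?V (-b))"
    using arg_cong[OF net_label_law[OF d x], of "\<lambda>M. measure_pmf.prob M {v. v > 0}" m b "\<theta>(x := -1)"]
    by (simp add: prob_bind_pmf vimage_def)
  moreover have "2 * mean_bayes m d b
      = 1 - (measure_pmf.expectation ?B (?V b) - measure_pmf.expectation ?B (?V (-b)))"
  proof -
    have "s_gap n b = ?V b n - ?V (-b) n" for n
      unfolding prob_V_pmf_diff[OF b'(1)] s_gap_eq[OF b] ..
    then show ?thesis by (simp add: bayes_def)
  qed
  ultimately show ?thesis by linarith
qed

section \<open>Averaging the risk over all sign vectors\<close>

lemma finite_hypotheses [simp]: "finite (hypotheses d)"
  by (simp add: hypotheses_def finite_PiE labels_Y_def)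

lemma hypotheses_nonempty [simp]: "hypotheses d \<noteq> {}"
  by (simp add: hypotheses_def PiE_eq_empty_iff labels_Y_def)

lemma hypotheses_labels: "h \<in> hypotheses d \<Longrightarrow> x \<in> domain_X d \<Longrightarrow> h x = -1 \<or> h x = 1"
  by (auto simp: hypotheses_def labels_Y_def PiE_iff)

lemma flip_hypothesis: "h \<in> hypotheses d \<Longrightarrow> x \<in> domain_X d \<Longrightarrow> h(x := - h x) \<in> hypotheses d"
  by (auto simp: hypotheses_def labels_Y_def PiE_iff extensional_def)

text \<open>Flipping coordinate \<open>x\<close> permutes the sign vectors, so twice the sum is a
  sum over pairs, each bounded by the two-point test.\<close>

lemma sum_error_prob_ge:
  assumes d: "d \<ge> 1" and x: "x \<in> domain_X d" and b: "b \<in> {0..1}"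
  shows "real (card (hypotheses d)) * mean_bayes m d b
    \<le> (\<Sum>\<theta>\<in>hypotheses d. measure_pmf.prob (replicate_pmf m (hard_pmf d b \<theta>)) {z. L z x \<noteq> \<theta> x})"
proof -
  let ?H = "hypotheses d" and ?\<beta> = "mean_bayes m d b"
  define f where "f \<theta> = measure_pmf.prob (replicate_pmf m (hard_pmf d b \<theta>)) {z. L z x \<noteq> \<theta> x}" for \<theta>
  let ?flip = "\<lambda>\<theta>. \<theta>(x := - \<theta> x)"
  have "bij_betw ?flip ?H ?H"
    using x by (intro bij_betwI[where g = ?flip]) (auto intro: flip_hypothesis)
  then have flip: "(\<Sum>\<theta>\<in>?H. f (?flip \<theta>)) = sum f ?H"
    by (rule sum.reindex_bij_betw)
  have pair: "2 * ?\<beta> \<le> f \<theta> + f (?flip \<theta>)" if "\<theta> \<in> ?H" for \<theta>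
    using hypotheses_labels[OF that x]
  proof
    assume "\<theta> x = 1"
    then show ?thesis
      using two_point_bound[where \<theta> = \<theta> and g = "\<lambda>z. L z x", OF d x b, of m] by (simp add: f_def)
  next
    \<comment> \<open>The two-point bound is applied to the flipped vector, whose own flip is
      \<open>\<theta>\<close>.\<close>
    assume "\<theta> x = -1"
    moreover from this have "\<theta>(x := -1) = \<theta>" by (simp add: fun_eq_iff)
    ultimately show ?thesis
      using two_point_bound[where \<theta> = "\<theta>(x := 1)" and g = "\<lambda>z. L z x", OF d x b, of m]
      by (simp add: f_def)
  qed
  have "real (card ?H) * (2 * ?\<beta>) \<le> (\<Sum>\<theta>\<in>?H. f \<theta> + f (?flip \<theta>))"
    using sum_mono[of ?H "\<lambda>_. 2 * ?\<beta>", OF pair] by simp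
  also have "\<dots> = 2 * sum f ?H" by (simp add: sum.distrib flip)
  finally show ?thesis by (simp add: f_def)
qed

text \<open>At each point the error is \<open>(1 - b) / 2\<close> when \<open>h\<close> agrees with
  \<open>\<theta>\<close> and \<open>(1 + b) / 2\<close> otherwise.\<close>

lemma err_hard_pmf:
  assumes d: "d \<ge> 1" and b: "b \<in> {0..1}" and h: "h \<in> hypotheses d" and \<theta>: "\<theta> \<in> hypotheses d"
  shows "err h (hard_pmf d b \<theta>)
    = (1 - b) / 2 + b / real d * (\<Sum>x\<in>domain_X d. if h x \<noteq> \<theta> x then 1 else 0)"
proof -
  have "measure_pmf.prob (sign_pmf (b * real_of_int (\<theta> x))) {y. h x \<noteq> y}
      = (1 - b) / 2 + b * (if h x \<noteq> \<theta> x then 1 else 0)" if "x \<in> domain_X d" for x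
  proof -
    let ?M = "sign_pmf (b * real_of_int (\<theta> x))"
    have hx: "h x = -1 \<or> h x = 1" "\<theta> x = -1 \<or> \<theta> x = 1"
      using hypotheses_labels h \<theta> that by auto
    have "measure_pmf.prob ?M {y. h x \<noteq> y} = 1 - pmf ?M (h x)"
      using measure_pmf.prob_compl[of "{h x}" ?M]
      by (simp add: measure_pmf_single Compl_eq_Diff_UNIV[symmetric] Collect_neg_eq)
    then show ?thesis using hx b by (auto simp: pmf_sign_pmf field_simps)
  qed
  then have "err h (hard_pmf d b \<theta>)
      = (\<Sum>x\<in>domain_X d. (1 - b) / 2 + b * (if h x \<noteq> \<theta> x then 1 else 0)) / real d"
    using d unfolding err_def hard_pmf_def prob_bind_pmf
    by (subst integral_pmf_of_set) (simp_all add: vimage_def)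
  also have "\<dots> = (1 - b) / 2 + b / real d * (\<Sum>x\<in>domain_X d. if h x \<noteq> \<theta> x then 1 else 0)"
    using d unfolding sum.distrib sum_distrib_left[symmetric] sum_constant domain_X_simps(2)
    by (simp add: add_divide_distrib)
  finally show ?thesis .
qed

text \<open>The minimal error is attained at \<open>\<theta>\<close> itself. The sum form turns
  expected excess risk into error probabilities at single points.\<close>

lemma excess_risk_hard_pmf:
  assumes d: "d \<ge> 1" and b: "b \<in> {0..1}" and h: "h \<in> hypotheses d" and \<theta>: "\<theta> \<in> hypotheses d"
  shows "excess_risk d h (hard_pmf d b \<theta>)
    = (\<Sum>x\<in>domain_X d. b / real d * (if h x \<noteq> \<theta> x then 1 else 0))"
proof -
  have Min: "Min ((\<lambda>g. err g (hard_pmf d b \<theta>)) ` hypotheses d) = (1 - b) / 2"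
  proof (rule Min_eqI)
    show "(1 - b) / 2 \<in> (\<lambda>g. err g (hard_pmf d b \<theta>)) ` hypotheses d"
      using err_hard_pmf[OF d b \<theta> \<theta>] \<theta> by (intro image_eqI[of _ _ \<theta>]) auto
  next
    fix e assume "e \<in> (\<lambda>g. err g (hard_pmf d b \<theta>)) ` hypotheses d"
    then obtain g where g: "g \<in> hypotheses d" "e = err g (hard_pmf d b \<theta>)" by auto
    have "0 \<le> b / real d * (\<Sum>x\<in>domain_X d. if g x \<noteq> \<theta> x then 1 else 0)"
      using b by (intro mult_nonneg_nonneg sum_nonneg) auto
    then show "(1 - b) / 2 \<le> e"
      unfolding g(2) err_hard_pmf[OF d b g(1) \<theta>] by simp
  qed simp
  show ?thesis
    unfolding excess_risk_def err_hard_pmf[OF assms] Min by (simp add: sum_distrib_left)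
qed

lemma finite_samples: "finite (samples m d)"
proof -
  have "samples m d = {z. set z \<subseteq> domain_X d \<times> labels_Y \<and> length z = m}"
    by (auto simp: samples_def)
  then show ?thesis by (simp add: finite_lists_length_eq labels_Y_def)
qed

lemma set_replicate_pmf_subset_samples:
  "D \<in> distributions d \<Longrightarrow> set_pmf (replicate_pmf m D) \<subseteq> samples m d"
  by (auto simp: set_replicate_pmf samples_def distributions_def)

text \<open>\<open>L\<close> is constrained only on \<open>samples\<close>, so that the bound also
  covers a randomized learner at a fixed seed.\<close>

lemma sum_risk_ge:
  assumes d: "d \<ge> 1" and b: "b \<in> {0..1}" and L: "\<And>z. z \<in> samples m d \<Longrightarrow> L z \<in> hypotheses d"
  shows "real (card (hypotheses d)) * (b * mean_bayes m d b)
    \<le> (\<Sum>\<theta>\<in>hypotheses d. risk m d L (hard_pmf d b \<theta>))"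
proof -
  let ?H = "hypotheses d" and ?\<beta> = "mean_bayes m d b"
  let ?P = "\<lambda>\<theta>. measure_pmf.prob (replicate_pmf m (hard_pmf d b \<theta>))"
  have risk: "risk m d L (hard_pmf d b \<theta>) = (\<Sum>x\<in>domain_X d. b / real d * ?P \<theta> {z. L z x \<noteq> \<theta> x})"
    if \<theta>: "\<theta> \<in> ?H" for \<theta>
  proof -
    let ?R = "replicate_pmf m (hard_pmf d b \<theta>)"
    have supp: "set_pmf ?R \<subseteq> samples m d"
      using hard_pmf_in_distributions[OF d] by (rule set_replicate_pmf_subset_samples)
    have fin: "integrable (measure_pmf ?R) f" for f :: "_ \<Rightarrow> real"
      by (intro integrable_measure_pmf_finite finite_subset[OF supp finite_samples])
    have "risk m d L (hard_pmf d b \<theta>)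
       = measure_pmf.expectation ?R (\<lambda>z. \<Sum>x\<in>domain_X d. b / real d * indicator {z. L z x \<noteq> \<theta> x} z)"
      unfolding risk_def
    proof (intro integral_cong_AE AE_pmfI)
      fix z assume "z \<in> set_pmf ?R"
      then have Lz: "L z \<in> ?H" using supp L by blast
      show "excess_risk d (L z) (hard_pmf d b \<theta>)
          = (\<Sum>x\<in>domain_X d. b / real d * indicator {z. L z x \<noteq> \<theta> x} z)"
        unfolding excess_risk_hard_pmf[OF d b Lz \<theta>] by (intro sum.cong) (auto simp: indicator_def)
    qed simp_all
    also have "\<dots> = (\<Sum>x\<in>domain_X d. b / real d * ?P \<theta> {z. L z x \<noteq> \<theta> x})"
      by (subst Bochner_Integration.integral_sum) (simp_all add: fin)
    finally show ?thesis .
  qed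
  \<comment> \<open>The \<open>d\<close> weights \<open>b / d\<close> add up to
    \<open>b\<close>.\<close>
  have "real (card ?H) * (b * ?\<beta>) = (\<Sum>x\<in>domain_X d. b / real d * (real (card ?H) * ?\<beta>))"
    using d unfolding sum_constant domain_X_simps(2) by (simp add: field_simps)
  also have "\<dots> \<le> (\<Sum>x\<in>domain_X d. b / real d * (\<Sum>\<theta>\<in>?H. ?P \<theta> {z. L z x \<noteq> \<theta> x}))"
    using b by (intro sum_mono mult_left_mono sum_error_prob_ge d) auto
  also have "\<dots> = (\<Sum>\<theta>\<in>?H. risk m d L (hard_pmf d b \<theta>))"
    unfolding sum_distrib_left by (subst sum.swap) (intro sum.cong refl risk[symmetric])
  finally show ?thesis .
qed

section \<open>Bounded risks and randomized learners\<close>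

lemma abs_excess_risk_le_1: "\<bar>excess_risk d h D\<bar> \<le> 1"
proof -
  have "Min ((\<lambda>g. err g D) ` hypotheses d) \<in> (\<lambda>g. err g D) ` hypotheses d"
    by (intro Min_in) auto
  then obtain g where "Min ((\<lambda>g. err g D) ` hypotheses d) = err g D" by (elim imageE)
  moreover have "0 \<le> err f D \<and> err f D \<le> 1" for f by (simp add: err_def)
  from this[of g] this[of h] have "\<bar>err h D - err g D\<bar> \<le> 1" by linarith
  ultimately show ?thesis by (simp only: excess_risk_def)
qed

text \<open>A non-integrable function has integral 0 by convention, which also respects the
  bound.\<close>

lemma (in prob_space) integral_le_1_of_abs_le_1:
  fixes f :: "'a \<Rightarrow> real"
  assumes "\<And>x. \<bar>f x\<bar> \<le> 1"
  shows "integral\<^sup>L M f \<le> 1"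
proof (cases "integrable M f")
  case True
  then show ?thesis using assms by (intro integral_le_const) (auto simp: abs_le_iff)
next
  case False
  then show ?thesis by (simp add: not_integrable_integral_eq)
qed

lemma prob_space_uniform_seed: "prob_space (uniform_measure lborel {-1..1::real})"
  by (rule prob_space_uniform_measure) auto

lemma risk_le_1: "risk m d L D \<le> 1"
  unfolding risk_def by (intro measure_pmf.integral_le_1_of_abs_le_1 abs_excess_risk_le_1)

lemma risk_rand_le_1: "risk_rand m d L D \<le> 1"
proof -
  interpret U: prob_space "uniform_measure lborel {-1..1::real}" by (rule prob_space_uniform_seed)
  interpret pair_prob_space "measure_pmf (replicate_pmf m D)" "uniform_measure lborel {-1..1::real}" ..
  show ?thesis
    unfolding risk_rand_def by (intro integral_le_1_of_abs_le_1 abs_excess_risk_le_1)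
qed

text \<open>Fubini: a randomized learner is a mixture of the deterministic learners obtained by
  fixing the seed.\<close>

lemma risk_rand_eq_integral_risk:
  assumes L: "L \<in> rand_learners m d"
  shows "integrable (uniform_measure lborel {-1..1}) (\<lambda>u. risk m d (\<lambda>z. L (z, u)) D)"
    and "risk_rand m d L D = (\<integral>u. risk m d (\<lambda>z. L (z, u)) D \<partial>uniform_measure lborel {-1..1})"
proof -
  let ?U = "uniform_measure lborel {-1..1::real}" and ?R = "measure_pmf (replicate_pmf m D)"
  interpret U: prob_space ?U by (rule prob_space_uniform_seed)
  interpret P: pair_prob_space ?R ?U ..
  have meas: "(\<lambda>u. excess_risk d (L (z, u)) D) \<in> borel_measurable borel" for z
  proof -
    \<comment> \<open>By extensionality \<open>L\<close> is constant off its domain, which extends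
      measurability from \<open>{-1..1}\<close> to the line.\<close>
    have out: "L (z, u) = undefined" if "z \<notin> samples m d \<or> u \<notin> {-1..1}" for u
      using L that by (auto simp: rand_learners_def PiE_iff extensional_def)
    show ?thesis
    proof (cases "z \<in> samples m d")
      case True
      with L have "(\<lambda>u. L (z, u)) \<in> measurable (restrict_space borel {-1..1}) (count_space (hypotheses d))"
        by (auto simp: rand_learners_def)
      then have "(\<lambda>u. excess_risk d (L (z, u)) D) \<in> borel_measurable (restrict_space borel {-1..1})"
        by (rule measurable_compose) simp
      then have "(\<lambda>u. if u \<in> {-1..1} then excess_risk d (L (z, u)) D else excess_risk d undefined D)
          \<in> borel_measurable borel"
        by (subst measurable_restrict_space_iff[symmetric]) auto
      also have "(\<lambda>u. if u \<in> {-1..1} then excess_risk d (L (z, u)) D else excess_risk d undefined D)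
          = (\<lambda>u. excess_risk d (L (z, u)) D)"
        by (auto simp: fun_eq_iff out)
      finally show ?thesis .
    qed (simp add: out)
  qed
  \<comment> \<open>There are countably many lists, so measurability of each section gives joint
    measurability.\<close>
  have "(\<lambda>zu. excess_risk d (L zu) D) \<in> borel_measurable (count_space UNIV \<Otimes>\<^sub>M borel)"
    by (intro measurable_pair_measure_countable1 meas) auto
  also have "borel_measurable (count_space UNIV \<Otimes>\<^sub>M borel) = borel_measurable (?R \<Otimes>\<^sub>M ?U)"
    by (intro measurable_cong_sets sets_pair_measure_cong) auto
  finally have "integrable (?R \<Otimes>\<^sub>M ?U) (\<lambda>zu. excess_risk d (L zu) D)"
    by (intro P.integrable_const_bound[where B = 1]) (auto simp: abs_excess_risk_le_1)
  then have int: "integrable (?R \<Otimes>\<^sub>M ?U) (\<lambda>(z, u). excess_risk d (L (z, u)) D)"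
    by (simp add: case_prod_beta')
  show "integrable ?U (\<lambda>u. risk m d (\<lambda>z. L (z, u)) D)"
    unfolding risk_def by (rule P.integrable_snd[OF int])
  show "risk_rand m d L D = (\<integral>u. risk m d (\<lambda>z. L (z, u)) D \<partial>?U)"
    unfolding risk_def risk_rand_def P.integral_snd[OF int] by (simp add: case_prod_beta')
qed

lemma sum_risk_rand_ge:
  assumes d: "d \<ge> 1" and b: "b \<in> {0..1}" and L: "L \<in> rand_learners m d"
  shows "real (card (hypotheses d)) * (b * mean_bayes m d b)
    \<le> (\<Sum>\<theta>\<in>hypotheses d. risk_rand m d L (hard_pmf d b \<theta>))" (is "?c \<le> _")
proof -
  let ?U = "uniform_measure lborel {-1..1::real}"
  interpret U: prob_space ?U by (rule prob_space_uniform_seed)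
  \<comment> \<open>At seeds outside the interval \<open>L\<close> need not yield a hypothesis, so
    the bound is used almost everywhere.\<close>
  have "AE u in ?U. u \<in> {-1..1}"
    by (intro AE_uniform_measureI) auto
  moreover have "?c \<le> (\<Sum>\<theta>\<in>hypotheses d. risk m d (\<lambda>z. L (z, u)) (hard_pmf d b \<theta>))" if "u \<in> {-1..1}" for u
    using L that by (intro sum_risk_ge d b) (auto simp: rand_learners_def PiE_iff)
  ultimately have "?c \<le> (\<integral>u. (\<Sum>\<theta>\<in>hypotheses d. risk m d (\<lambda>z. L (z, u)) (hard_pmf d b \<theta>)) \<partial>?U)"
    by (intro U.integral_ge_const Bochner_Integration.integrable_sum risk_rand_eq_integral_risk(1)[OF L]) auto
  also have "\<dots> = (\<Sum>\<theta>\<in>hypotheses d. risk_rand m d L (hard_pmf d b \<theta>))"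
    by (simp add: Bochner_Integration.integral_sum risk_rand_eq_integral_risk[OF L])
  finally show ?thesis .
qed

section \<open>Passing to the supremum over distributions and the infimum over learners\<close>

lemma learners_nonempty: "learners m d \<noteq> {}"
  by (simp add: learners_def PiE_eq_empty_iff)

lemma rand_learners_nonempty: "rand_learners m d \<noteq> {}"
proof -
  obtain h where h: "h \<in> hypotheses d" using hypotheses_nonempty by blast
  let ?L = "restrict (\<lambda>_. h) (samples m d \<times> {-1..1::real})"
  have "(\<lambda>u. ?L (z, u)) \<in> measurable (restrict_space borel {-1..1}) (count_space (hypotheses d))"
    if "z \<in> samples m d" for z
    using that h by (subst measurable_cong[where g = "\<lambda>_. h"]) (auto simp: space_restrict_space)
  with h have "?L \<in> rand_learners m d" by (auto simp: rand_learners_def)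
  then show ?thesis by blast
qed

text \<open>Here \<open>R\<close> is the risk of a fixed learner of either kind. An average over the
  hard distributions is at most the supremum, which \<open>bound\<close> makes finite.\<close>

lemma B0_le_SUP:
  assumes d: "d \<ge> 1" and bound: "\<And>D. R D \<le> 1"
    and avg: "\<And>b. b \<in> {0..1} \<Longrightarrow>
      real (card (hypotheses d)) * (b * mean_bayes m d b)
      \<le> (\<Sum>\<theta>\<in>hypotheses d. R (hard_pmf d b \<theta>))"
  shows "B\<^sub>0 m d \<le> (SUP D\<in>distributions d. R D)"
  unfolding B\<^sub>0_def
proof (rule cSUP_least)
  fix b :: real assume b: "b \<in> {0..1}"
  have "(\<Sum>\<theta>\<in>hypotheses d. R (hard_pmf d b \<theta>)) \<le> real (card (hypotheses d)) * (SUP D\<in>distributions d. R D)"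
    using d bound by (intro sum_bounded_above cSUP_upper hard_pmf_in_distributions bdd_aboveI2)
  with avg[OF b] have "real (card (hypotheses d)) * (b * mean_bayes m d b)
     \<le> real (card (hypotheses d)) * (SUP D\<in>distributions d. R D)" by linarith
  then show "b * mean_bayes m d b
      \<le> (SUP D\<in>distributions d. R D)"
    by (simp add: card_gt_0_iff)
qed auto

theorem theorem2p9:
  fixes d m :: nat and \<nu> :: real
  assumes "d \<ge> 1" and "\<nu> = real m / real d"
  shows "(INF L\<in>learners m d. SUP D\<in>distributions d. risk m d L D) \<ge> B\<^sub>0 m d
    \<and> (INF L\<in>rand_learners m d. SUP D\<in>distributions d. risk_rand m d L D) \<ge> B\<^sub>0 m d
    \<and> B\<^sub>0 m d \<ge> B\<^sub>1 \<nu>"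
proof (intro conjI)
  show "(INF L\<in>learners m d. SUP D\<in>distributions d. risk m d L D) \<ge> B\<^sub>0 m d"
    using assms by (intro cINF_greatest learners_nonempty B0_le_SUP risk_le_1 sum_risk_ge)
      (auto simp: learners_def)
  show "(INF L\<in>rand_learners m d. SUP D\<in>distributions d. risk_rand m d L D) \<ge> B\<^sub>0 m d"
    using assms
    by (intro cINF_greatest rand_learners_nonempty B0_le_SUP risk_rand_le_1 sum_risk_rand_ge)
  show "B\<^sub>0 m d \<ge> B\<^sub>1 \<nu>"
    using assms by (simp add: B1_le_B0)
qed

end
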